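(* Let $X$ be a finite graph with edge set $E(X)$, let $|E(X)|$ be the number of its edges, and let $\deg(X)$ be its degree. Let $F_1(X)$ be its first spectral density function. Then for all real $\lambda$ with $0 \le \lambda < 1$, $$F_1(X)(\lambda) - F_1(X)(0) \le 2 \cdot |E(X)| \cdot \deg(X) \cdot \lambda .$$
   Context: A finite graph $X$ has a finite vertex set $V(X)$ and a finite edge set $E(X)$; loops and multiple edges are allowed (equivalently, $X$ is a finite one-dimensional CW complex). Each edge $e$ is given an orientation, with initial vertex $v_0(e)$ and terminal vertex $v_1(e)$; the quantities below do not depend on the choice of orientations. The degree $d_v$ of a vertex $v$ is the number of edges having precisely one endpoint equal to $v$ plus twice the number of edges both of whose endpoints equal $v$. The degree of $X$ is $\deg(X) = \max\{d_v \mid v \in V(X)\}$. Let $C_1(X) = l^2(E(X))$ and $C_0(X) = l^2(V(X))$ be the real vector spaces of sequences of real numbers indexed by $E(X)$ and $V(X)$, with the standard Euclidean inner products. Define the linear map $$c_1 \colon C_1(X) \to C_0(X), \quad (a_e)_{e \in E(X)} \mapsto \Big( \sum_{e :\, v_1(e) = v} a_e - \sum_{e :\, v_0(e) = v} a_e \Big)_{v \in V(X)} .$$ For a linear map $f \colon V \to W$ of finite-dimensional Hilbert spaces, its spectral density function $F(f) \colon [0,\infty) \to [0,\infty)$ sends $\lambda$ to the supremum of the dimensions of all linear subspaces $V_0 \subseteq V$ such that $|f(v)| \le \lambda \cdot |v|$ for all $v \in V_0$. (Thus $F(f)(\lambda) - F(f)(0)$ is the number of non-zero singular values of $f$, counted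 with multiplicity, that are $\le \lambda$.) The first spectral density function of $X$ is $F_1(X) := F(c_1 \colon C_1(X) \to C_0(X))$. *)

theory Defs
  imports "HOL-Analysis.Analysis" "Graph_Theory.Digraph"
begin

text \<open>
  A finite graph (loops and multiple edges allowed) together with a choice of orientation is a
  \<^locale>\<open>fin_digraph\<close> \<open>G\<close>, where \<open>tail\<close> is the initial vertex \<open>v\<^sub>0\<close> and \<open>head\<close> the terminal
  vertex \<open>v\<^sub>1\<close>. Vertices and edges are drawn from ambient finite types \<open>'v\<close> and \<open>'e\<close>, but
  \<open>verts G\<close> and \<open>arcs G\<close> may be arbitrary subsets of them (possibly empty).
\<close>

definition vertex_degree :: "('v, 'e) pre_digraph \<Rightarrow> 'v \<Rightarrow> nat" where
  "vertex_degree G v =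
     card {e \<in> arcs G. (tail G e = v) \<noteq> (head G e = v)}
     + 2 * card {e \<in> arcs G. tail G e = v \<and> head G e = v}"

text \<open>The inserted \<open>0\<close> only matters for the graph without vertices.\<close>

definition graph_degree :: "('v, 'e) pre_digraph \<Rightarrow> nat" where
  "graph_degree G = Max (insert 0 (vertex_degree G ` verts G))"

text \<open>
  \<open>l2_on S\<close> is \<open>l\<^sup>2(S)\<close> for a subset \<open>S\<close> of a finite type: sequences are extended by \<open>0\<close>, so that
  the norm of \<open>real ^ 'i\<close> restricts to the Euclidean norm of \<open>l\<^sup>2(S)\<close>.
\<close>

definition l2_on :: "'i::finite set \<Rightarrow> (real ^ 'i) set" where
  "l2_on S = {x. \<forall>i. i \<notin> S \<longrightarrow> x $ i = 0}"

lemma subspace_l2_on: "subspace (l2_on S)"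
  by (auto simp: subspace_def l2_on_def)

definition c1 :: "('v::finite, 'e::finite) pre_digraph \<Rightarrow> real ^ 'e \<Rightarrow> real ^ 'v" where
  "c1 G a = (\<chi> v. (\<Sum>e | e \<in> arcs G \<and> head G e = v. a $ e)
                - (\<Sum>e | e \<in> arcs G \<and> tail G e = v. a $ e))"

lemma linear_c1: "linear (c1 G)"
  by (rule linearI)
     (simp_all add: c1_def vec_eq_iff sum.distrib sum_distrib_left right_diff_distrib)

lemma c1_in_l2_on:
  assumes "fin_digraph G"
  shows "c1 G a \<in> l2_on (verts G)"
proof -
  interpret fin_digraph G by (rule assms)
  have "c1 G a $ v = 0" if "v \<notin> verts G" for v
  proof -
    have *: "{e. e \<in> arcs G \<and> head G e = v} = {}" "{e. e \<in> arcs G \<and> tail G e = v} = {}"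
      using that by auto
    show ?thesis
      unfolding c1_def by (simp only: vec_lambda_beta * sum.empty diff_self)
  qed
  then show ?thesis
    by (simp add: l2_on_def)
qed

text \<open>
  The spectral density function of the restriction of \<open>f\<close> to the subspace \<open>V\<close>. The supremum is
  taken in \<^typ>\<open>real\<close>; the set of dimensions is non-empty and bounded, see below.
\<close>

definition spectral_density ::
  "'a::euclidean_space set \<Rightarrow> ('a \<Rightarrow> 'b::euclidean_space) \<Rightarrow> real \<Rightarrow> real" where
  "spectral_density V f l =
     Sup {real (dim V0) | V0. subspace V0 \<and> V0 \<subseteq> V \<and> (\<forall>x\<in>V0. norm (f x) \<le> l * norm x)}"

lemma spectral_density_bdd_above:
  fixes f :: "'a::euclidean_space \<Rightarrow> 'b::euclidean_space"
  shows "bdd_above {real (dim V0) | V0. subspace V0 \<and> V0 \<subseteq> V \<and>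
           (\<forall>x\<in>V0. norm (f x) \<le> l * norm x)}"
  by (rule bdd_aboveI[where M = "real DIM('a)"]) (auto intro: dim_subset_UNIV)

lemma spectral_density_nonempty:
  fixes f :: "'a::euclidean_space \<Rightarrow> 'b::euclidean_space"
  assumes "subspace V" "linear f"
  shows "{real (dim V0) | V0. subspace V0 \<and> V0 \<subseteq> V \<and>
           (\<forall>x\<in>V0. norm (f x) \<le> l * norm x)} \<noteq> {}"
proof -
  have "subspace {0::'a} \<and> {0} \<subseteq> V \<and> (\<forall>x\<in>{0}. norm (f x) \<le> l * norm x)"
    using assms by (simp add: subspace_0 linear_0)
  then show ?thesis by blast
qed

definition F1 :: "('v::finite, 'e::finite) pre_digraph \<Rightarrow> real \<Rightarrow> real" where
  "F1 G = spectral_density (l2_on (arcs G)) (c1 G)"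

end

theory Submission
  imports Defs
begin

text \<open>
  Choose a spanning forest of the graph, rooted so that every edge joins a vertex to its parent; the
  number of its edges is the rank of \<open>c\<^sub>1\<close>. With \<open>k = \<lceil>1 / \<lambda>\<rceil>\<close>, at most \<open>|E| / k \<le> |E| \<lambda>\<close> edges have to be
  deleted from the forest for every remaining edge to have fewer than \<open>k\<close> vertices below it. A chain
  \<open>x\<close> on the remaining edges is recovered from \<open>y = c\<^sub>1 x\<close>: up to sign, \<open>x\<^sub>e\<close> is the sum of \<open>y\<close> over the
  vertices below \<open>e\<close>. As a vertex also lies below fewer than \<open>k\<close> remaining edges, Cauchy--Schwarz gives
  \<open>|x| \<le> (k - 1) |y|\<close> with \<open>(k - 1) \<lambda> < 1\<close>. So a subspace on which \<open>|c\<^sub>1 x| \<le> \<lambda> |x|\<close> meets the space of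
  these chains only in \<open>0\<close>, which bounds its dimension.
\<close>

section \<open>Subtrees of a rooted forest\<close>

text \<open>A vertex \<open>v\<close> in \<open>M\<close> also stands for the forest edge from
  \<open>v\<close> to its parent \<open>f v\<close>, so deleting edges means shrinking
  \<open>M\<close>. Vertices outside \<open>M\<close> are the roots.\<close>

definition parent_rel :: "'v set \<Rightarrow> ('v \<Rightarrow> 'v) \<Rightarrow> 'v rel" where
  "parent_rel M f = {(u, f u) | u. u \<in> M}"

definition descendants :: "'v set \<Rightarrow> ('v \<Rightarrow> 'v) \<Rightarrow> 'v \<Rightarrow> 'v set" where
  "descendants M f v = {w. (w, v) \<in> (parent_rel M f)\<^sup>*}"

lemma descendants_self: "v \<in> descendants M f v"
  by (simp add: descendants_def)

lemma descendants_mono: "M \<subseteq> M' \<Longrightarrow> descendants M f v \<subseteq> descendants M' f v"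
proof -
  assume "M \<subseteq> M'"
  then have "parent_rel M f \<subseteq> parent_rel M' f" by (auto simp: parent_rel_def)
  then show ?thesis unfolding descendants_def by (auto dest: rtrancl_mono)
qed

lemma descendants_subset:
  assumes "v \<in> M"
  shows "descendants M f v \<subseteq> M"
proof
  fix w
  assume "w \<in> descendants M f v"
  then have "(w, v) \<in> (parent_rel M f)\<^sup>*" by (simp add: descendants_def)
  then show "w \<in> M"
    using assms by (cases rule: converse_rtranclE) (auto simp: parent_rel_def)
qed

lemma parent_in_descendants:
  assumes "w \<in> descendants M f v" "w \<noteq> v"
  shows "w \<in> M" "f w \<in> descendants M f v"
proof -
  have "(w, v) \<in> (parent_rel M f)\<^sup>*" using assms by (simp add: descendants_def)
  then show "w \<in> M" "f w \<in> descendants M f v"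
    using assms by (cases rule: converse_rtranclE; auto simp: parent_rel_def descendants_def)+
qed

lemma child_in_descendants:
  assumes "f w \<in> descendants M f v" "w \<in> M"
  shows "w \<in> descendants M f v"
  using assms unfolding descendants_def parent_rel_def
  by (auto intro: converse_rtrancl_into_rtrancl)

text \<open>The height \<open>h\<close> drops at every step towards a root. This excludes cycles and
  makes being a descendant antisymmetric.\<close>

lemma descendants_rank:
  fixes h :: "'v \<Rightarrow> nat"
  assumes dec: "\<And>v. v \<in> M \<Longrightarrow> h (f v) < h v" and "w \<in> descendants M f v"
  shows "w = v \<or> h v < h w"
proof -
  have "(w, v) \<in> (parent_rel M f)\<^sup>*" using assms by (simp add: descendants_def)
  then show ?thesis
  proof (induction rule: converse_rtrancl_induct)
    case (step a b)
    then show ?case using dec[of a] by (auto simp: parent_rel_def)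
  qed simp
qed

section \<open>Forests with small subtrees: norm bound and cutting\<close>

text \<open>With forest edges oriented towards the child, \<open>x v\<close> is the value of a chain
  on the edge above \<open>v\<close>, and the difference on the right is its boundary at
  \<open>v\<close>. One factor \<open>K\<close> comes from Cauchy-Schwarz over a subtree, the other
  from counting ancestors.\<close>

lemma forest_bounded_below:
  fixes h :: "'v \<Rightarrow> nat" and x :: "'v \<Rightarrow> real"
  assumes fin: "finite M"
    and dec: "\<And>v. v \<in> M \<Longrightarrow> h (f v) < h v"
    and small: "\<And>v. v \<in> M \<Longrightarrow> card (descendants M f v) \<le> K"
  shows "(\<Sum>v\<in>M. (x v)\<^sup>2)
    \<le> (real K)\<^sup>2 * (\<Sum>v\<in>M. (x v - (\<Sum>u | u \<in> M \<and> f u = v. x u))\<^sup>2)"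
proof -
  define y where "y v = x v - (\<Sum>u | u \<in> M \<and> f u = v. x u)" for v
  let ?D = "descendants M f"
  have finD: "finite (?D v)" if "v \<in> M" for v
    using descendants_subset[OF that] fin by (rule finite_subset)
  have flow: "x v = (\<Sum>w\<in>?D v. y w)" if v: "v \<in> M" for v
  proof -
    \<comment> \<open>The edges whose upper end lies in the subtree of \<open>v\<close> are those
      above its vertices other than \<open>v\<close>. Hence summing \<open>y\<close> over the
      subtree cancels everything except \<open>x v\<close>.\<close>
    have children: "{u \<in> M. f u \<in> ?D v} = ?D v - {v}"
    proof (intro equalityI subsetI)
      fix u
      assume u: "u \<in> {u \<in> M. f u \<in> ?D v}"
      then have "f u = v \<or> h v < h (f u)" by (intro descendants_rank[of M h f] dec) auto
      then have "u \<noteq> v" using dec[of u] u by auto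
      moreover have "u \<in> ?D v" using u by (auto intro: child_in_descendants)
      ultimately show "u \<in> ?D v - {v}" by simp
    next
      fix u
      assume "u \<in> ?D v - {v}"
      then show "u \<in> {u \<in> M. f u \<in> ?D v}" using parent_in_descendants[of u M f v] by simp
    qed
    have "(\<Sum>w\<in>?D v. \<Sum>u | u \<in> M \<and> f u = w. x u)
        = (\<Sum>w\<in>?D v. sum x {u \<in> {u \<in> M. f u \<in> ?D v}. f u = w})"
      by (intro sum.cong refl Collect_cong arg_cong2[where f = sum]) auto
    also have "\<dots> = sum x {u \<in> M. f u \<in> ?D v}"
      by (rule sum.group) (use fin finD[OF v] in auto)
    also have "\<dots> = sum x (?D v) - x v"
      unfolding children using finD[OF v] descendants_self[of v M f]
      by (simp add: sum_diff1)
    finally show ?thesis by (simp add: y_def sum_subtractf)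
  qed
  have ancestors: "card {v \<in> M. w \<in> ?D v} \<le> K" if w: "w \<in> M" for w
  proof -
    let ?A = "{v \<in> M. w \<in> ?D v}"
    \<comment> \<open>Parents are unique, so the ancestors of \<open>w\<close> form a chain. All of
      them lie below the topmost one \<open>t\<close>, whose subtree has at most \<open>K\<close>
      vertices.\<close>
    have "w \<in> ?A" using w descendants_self by fastforce
    then obtain t where t: "t \<in> ?A" and tmin: "\<And>v. v \<in> ?A \<Longrightarrow> h t \<le> h v"
      using arg_min_nat_lemma[of "\<lambda>v. v \<in> ?A" w h] by blast
    have "?A \<subseteq> ?D t"
    proof
      fix v
      assume v: "v \<in> ?A"
      have "single_valued (parent_rel M f)"
        by (auto simp: single_valued_def parent_rel_def)
      moreover have "(w, t) \<in> (parent_rel M f)\<^sup>*" "(w, v) \<in> (parent_rel M f)\<^sup>*"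
        using t v by (auto simp: descendants_def)
      ultimately have "v \<in> ?D t \<or> t \<in> ?D v"
        unfolding descendants_def using single_valued_confluent by fastforce
      then show "v \<in> ?D t"
        using descendants_rank[of M h f t v, OF dec] tmin[OF v] by (auto simp: descendants_self)
    qed
    then show ?thesis
      using card_mono[of "?D t" ?A] finD[of t] small[of t] t by auto
  qed
  have "(\<Sum>v\<in>M. (x v)\<^sup>2) \<le> (\<Sum>v\<in>M. real K * (\<Sum>w\<in>?D v. (y w)\<^sup>2))"
  proof (rule sum_mono)
    fix v
    assume v: "v \<in> M"
    have "(x v)\<^sup>2 \<le> real (card (?D v)) * (\<Sum>w\<in>?D v. (y w)\<^sup>2)"
      unfolding flow[OF v] using sum_squared_le_sum_of_squares[of y "?D v"] by (simp only: mult.commute)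
    also have "\<dots> \<le> real K * (\<Sum>w\<in>?D v. (y w)\<^sup>2)"
      using small[OF v] by (intro mult_right_mono) (auto intro: sum_nonneg)
    finally show "(x v)\<^sup>2 \<le> \<dots>" .
  qed
  also have "\<dots> = real K * (\<Sum>v\<in>M. \<Sum>w | w \<in> M \<and> w \<in> ?D v. (y w)\<^sup>2)"
    using descendants_subset[of _ M f] unfolding sum_distrib_left
    by (intro sum.cong refl) auto
  also have "(\<Sum>v\<in>M. \<Sum>w | w \<in> M \<and> w \<in> ?D v. (y w)\<^sup>2)
      = (\<Sum>w\<in>M. \<Sum>v | v \<in> M \<and> w \<in> ?D v. (y w)\<^sup>2)"
    by (rule sum.swap_restrict) (use fin in auto)
  also have "\<dots> = (\<Sum>w\<in>M. real (card {v \<in> M. w \<in> ?D v}) * (y w)\<^sup>2)"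
    by simp
  also have "\<dots> \<le> (\<Sum>w\<in>M. real K * (y w)\<^sup>2)"
    using ancestors by (intro sum_mono mult_right_mono) auto
  also have "\<dots> = real K * (\<Sum>w\<in>M. (y w)\<^sup>2)"
    by (simp add: sum_distrib_left)
  finally have "(\<Sum>v\<in>M. (x v)\<^sup>2) \<le> real K * (real K * (\<Sum>w\<in>M. (y w)\<^sup>2))"
    by (simp add: mult_left_mono)
  then show ?thesis
    by (simp only: y_def power2_eq_square[of "real K"] mult.assoc)
qed

text \<open>Cut above a deepest vertex with at least \<open>k\<close> descendants, discard its subtree, repeat.\<close>

lemma exists_forest_cut:
  fixes h :: "'v \<Rightarrow> nat"
  assumes "finite N" and "\<And>v. v \<in> N \<Longrightarrow> h (f v) < h v"
  shows "\<exists>C\<subseteq>N. k * card C \<le> card N \<and> (\<forall>v\<in>N - C. card (descendants (N - C) f v) < k)"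
  using assms
proof (induction "card N" arbitrary: N rule: less_induct)
  case less
  note dec = less.prems(2)
  show ?case
  proof (cases "\<forall>v\<in>N. card (descendants N f v) < k")
    case True
    then show ?thesis by (intro exI[of _ "{}"]) auto
  next
    case False
    let ?big = "{v \<in> N. k \<le> card (descendants N f v)}"
    from False have "finite (h ` ?big)" "h ` ?big \<noteq> {}" using less.prems by auto
    then obtain v where v: "v \<in> N" "k \<le> card (descendants N f v)"
      and deepest: "\<And>u. u \<in> ?big \<Longrightarrow> h u \<le> h v"
      using Max_in[of "h ` ?big"] Max_ge[of "h ` ?big"] by fastforce
    define D where "D = descendants N f v"
    have DN: "D \<subseteq> N" unfolding D_def using v(1) by (rule descendants_subset)
    have vD: "v \<in> D" unfolding D_def by (rule descendants_self)
    have finD: "finite D" using DN less.prems(1) finite_subset by blast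
    have "card (N - D) < card N"
      using DN vD v(1) less.prems(1) by (intro psubset_card_mono) auto
    from less.hyps[OF this] less.prems obtain C'
      where C': "C' \<subseteq> N - D" "k * card C' \<le> card (N - D)"
        and IH: "\<And>u. u \<in> N - D - C' \<Longrightarrow> card (descendants (N - D - C') f u) < k"
      by (metis DiffD1 finite_Diff)
    let ?C = "insert v C'"
    \<comment> \<open>The at least \<open>k\<close> vertices of the discarded subtree
      \<open>D\<close> pay for the cut at \<open>v\<close>.\<close>
    have "v \<notin> C'" "finite C'" using C' vD less.prems(1) finite_subset by blast+
    then have "k * card ?C \<le> card (N - D) + card D"
      using C' v(2) by (simp add: D_def)
    also have "\<dots> = card N"
      using DN less.prems(1) by (simp add: card_Diff_subset finD card_mono)
    finally have "k * card ?C \<le> card N" .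
    moreover have "card (descendants (N - ?C) f u) < k" if u: "u \<in> N - ?C" for u
    proof (cases "u \<in> D")
      case True
      \<comment> \<open>A vertex of \<open>D\<close> other than \<open>v\<close> is deeper than
        \<open>v\<close>, so it had fewer than \<open>k\<close> descendants even before
        cutting.\<close>
      then have "h v < h u" using u descendants_rank[of N h f u v, OF dec] by (auto simp: D_def)
      then have "card (descendants N f u) < k" using deepest[of u] u by force
      moreover have "card (descendants (N - ?C) f u) \<le> card (descendants N f u)"
        using u less.prems(1) descendants_subset[of u N f]
        by (intro card_mono descendants_mono) (auto intro: finite_subset)
      ultimately show ?thesis by simp
    next
      case False
      then have u': "u \<in> N - D - C'" using u by auto
      \<comment> \<open>A path up to \<open>u\<close> outside \<open>D\<close> could leave
        \<open>D\<close> only through the edge above \<open>v\<close>, which is cut. So the vertices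
        still below \<open>u\<close> avoid \<open>D\<close>, and the induction hypothesis
        applies.\<close>
      have "w \<in> N - D - C' \<and> w \<in> descendants (N - D - C') f u"
        if "(w, u) \<in> (parent_rel (N - ?C) f)\<^sup>*" for w
        using that
      proof (induction rule: converse_rtrancl_induct)
        case base
        then show ?case using u' by (simp add: descendants_self)
      next
        case (step a b)
        then have a: "a \<in> N" "a \<noteq> v" "a \<notin> C'" "b = f a" by (auto simp: parent_rel_def)
        then have "a \<notin> D" using step.IH parent_in_descendants(2)[of a N f v] by (auto simp: D_def)
        then show ?case using a step.IH by (auto intro: child_in_descendants)
      qed
      then have "descendants (N - ?C) f u \<subseteq> descendants (N - D - C') f u"
        by (auto simp: descendants_def[of "N - ?C"])
      then have "card (descendants (N - ?C) f u) \<le> card (descendants (N - D - C') f u)"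
        using u' less.prems(1) descendants_subset[of u "N - D - C'" f]
        by (intro card_mono) (auto intro: finite_subset)
      then show ?thesis using IH[OF u'] by simp
    qed
    moreover have "?C \<subseteq> N" using v C' by auto
    ultimately show ?thesis by (intro exI[of _ ?C]) auto
  qed
qed

section \<open>Spanning forests\<close>

text \<open>A breadth-first forest: \<open>r v\<close> is a chosen representative of the component
  of \<open>v\<close>, \<open>h v\<close> the distance from it, and \<open>f v\<close> a neighbour
  nearer to it. The roots are the fixed points of \<open>r\<close>.\<close>

lemma exists_spanning_forest:
  assumes "sym A"
  obtains r f :: "'v \<Rightarrow> 'v" and h :: "'v \<Rightarrow> nat"
  where "\<And>u v. (u, v) \<in> A \<Longrightarrow> r u = r v"
    and "\<And>v. r v \<noteq> v \<Longrightarrow> (f v, v) \<in> A"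
    and "\<And>v. r v \<noteq> v \<Longrightarrow> h (f v) < h v"
proof -
  define r where "r v = (SOME u. (u, v) \<in> A\<^sup>*)" for v
  define h where "h v = (LEAST n. (r v, v) \<in> A ^^ n)" for v
  have r: "(r v, v) \<in> A\<^sup>*" for v
    unfolding r_def by (rule someI[of _ v]) simp
  have r_eq: "r u = r v" if "(u, v) \<in> A" for u v
  proof -
    \<comment> \<open>By symmetry, \<open>u\<close> and \<open>v\<close> are reachable from the same
      vertices, so the choice operator returns the same representative for both.\<close>
    have "(v, u) \<in> A" using that assms by (auto dest: symD)
    then have "(w, u) \<in> A\<^sup>* \<longleftrightarrow> (w, v) \<in> A\<^sup>*" for w
      using that by (meson rtrancl.rtrancl_into_rtrancl)
    then show ?thesis by (simp add: r_def)
  qed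
  have "\<exists>u. (u, v) \<in> A \<and> h u < h v" if "r v \<noteq> v" for v
  proof -
    have "(r v, v) \<in> A ^^ h v"
      unfolding h_def using r[of v] by (metis LeastI rtrancl_imp_relpow)
    moreover from this that obtain n where n: "h v = Suc n" by (cases "h v") auto
    ultimately obtain u where u: "(r v, u) \<in> A ^^ n" "(u, v) \<in> A" by auto
    then have "h u \<le> n" unfolding h_def r_eq[OF u(2)] by (intro Least_le)
    with u n show ?thesis by auto
  qed
  then obtain f where "\<And>v. r v \<noteq> v \<Longrightarrow> (f v, v) \<in> A \<and> h (f v) < h v" by metis
  with r_eq that show thesis by blast
qed

section \<open>Dimension bounds for the spectral density function\<close>

lemma dim_l2_on: "dim (l2_on S :: (real ^ 'i::finite) set) = card S"
  unfolding l2_on_def using dim_substandard_cart[where 'a = real] by (simp add: dim_vec_eq)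

lemma c1_eq_sum:
  "c1 G a = (\<Sum>e\<in>arcs G. a $ e *\<^sub>R (axis (head G e) 1 - axis (tail G e) 1))"
proof (rule vec_eq_iff[THEN iffD2], rule allI)
  fix v
  have "c1 G a $ v = (\<Sum>e\<in>arcs G. (if head G e = v then a $ e else 0))
      - (\<Sum>e\<in>arcs G. (if tail G e = v then a $ e else 0))"
    unfolding c1_def by (simp add: sum.inter_filter)
  also have "\<dots> = (\<Sum>e\<in>arcs G. a $ e *\<^sub>R (axis (head G e) 1 - axis (tail G e) 1)) $ v"
    unfolding sum_subtractf[symmetric] sum_component
    by (intro sum.cong) (auto simp: axis_def)
  finally show "c1 G a $ v
    = (\<Sum>e\<in>arcs G. a $ e *\<^sub>R (axis (head G e) 1 - axis (tail G e) 1)) $ v" .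
qed

lemma graph_degree_pos:
  assumes "fin_digraph G" "arcs G \<noteq> {}"
  shows "1 \<le> graph_degree G"
proof -
  interpret fin_digraph G by (rule assms)
  obtain e where e: "e \<in> arcs G" using assms by auto
  let ?v = "tail G e"
  have "vertex_degree G ?v \<ge> 1"
  proof (cases "head G e = ?v")
    case True
    then have "{a \<in> arcs G. tail G a = ?v \<and> head G a = ?v} \<noteq> {}" using e by auto
    then show ?thesis unfolding vertex_degree_def
      using finite_arcs by (simp add: Suc_le_eq card_gt_0_iff)
  next
    case False
    then have "{a \<in> arcs G. (tail G a = ?v) \<noteq> (head G a = ?v)} \<noteq> {}" using e by auto
    then show ?thesis unfolding vertex_degree_def
      using finite_arcs by (simp add: Suc_le_eq card_gt_0_iff)
  qed
  moreover have "vertex_degree G ?v \<le> graph_degree G"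
    unfolding graph_degree_def using e finite_verts by (intro Max_ge) auto
  ultimately show ?thesis by linarith
qed

text \<open>A min-max argument: every competitor in the supremum meets \<open>W\<close> only in 0,
  so its dimension and that of \<open>W\<close> add up to at most the number of arcs.\<close>

lemma F1_le:
  assumes "subspace W" "W \<subseteq> l2_on (arcs G)"
    and "\<And>x. x \<in> W \<Longrightarrow> norm (c1 G x) \<le> l * norm x \<Longrightarrow> x = 0"
  shows "F1 G l \<le> real (card (arcs G)) - real (dim W)"
  unfolding F1_def spectral_density_def
proof (rule cSup_least)
  show "{real (dim V0) |V0. subspace V0 \<and> V0 \<subseteq> l2_on (arcs G) \<and>
           (\<forall>x\<in>V0. norm (c1 G x) \<le> l * norm x)} \<noteq> {}"
    by (rule spectral_density_nonempty[OF subspace_l2_on linear_c1])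
next
  fix d
  assume "d \<in> {real (dim V0) |V0. subspace V0 \<and> V0 \<subseteq> l2_on (arcs G) \<and>
           (\<forall>x\<in>V0. norm (c1 G x) \<le> l * norm x)}"
  then obtain V0 where V0: "d = real (dim V0)" "subspace V0" "V0 \<subseteq> l2_on (arcs G)"
    "\<forall>x\<in>V0. norm (c1 G x) \<le> l * norm x" by blast
  have "V0 \<inter> W \<subseteq> {0}" using V0 assms by auto
  then have "dim (V0 \<inter> W) = 0" by (simp only: dim_eq_0)
  moreover have "{x + y |x y. x \<in> V0 \<and> y \<in> W} \<subseteq> l2_on (arcs G)"
    using V0 assms subspace_add[OF subspace_l2_on] by blast
  then have "dim {x + y |x y. x \<in> V0 \<and> y \<in> W} \<le> card (arcs G)"
    unfolding dim_l2_on[symmetric] by (rule dim_subset)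
  ultimately show "d \<le> real (card (arcs G)) - real (dim W)"
    using dim_sums_Int[OF V0(2) assms(1)] V0(1) by linarith
qed

text \<open>Rank-nullity on \<open>L\<close>: the orthogonal complement of the kernel within
  \<open>L\<close> is mapped injectively.\<close>

lemma dim_le_dim_kernel_plus_dim_image:
  fixes f :: "'a::euclidean_space \<Rightarrow> 'b::euclidean_space"
  assumes f: "linear f" and L: "subspace L"
  shows "dim L \<le> dim {x \<in> L. f x = 0} + dim (f ` L)"
proof -
  let ?K = "{x \<in> L. f x = 0}"
  let ?W = "{y \<in> L. \<forall>x\<in>?K. orthogonal x y}"
  have "subspace ?K"
    using f L by (auto simp: subspace_def linear_add linear_scale linear_0)
  then have "dim ?W + dim ?K = dim L"
    using L by (intro dim_subspace_orthogonal_to_vectors) auto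
  moreover have W: "subspace ?W"
    using L by (auto simp: subspace_def orthogonal_clauses)
  then have "inj_on f ?W"
    unfolding linear_inj_on_iff_eq_0[OF f W] by (auto simp: orthogonal_self)
  then have "inj_on f (span ?W)"
    by (simp only: span_eq_iff[THEN iffD2, OF W])
  then have "dim (f ` ?W) = dim ?W" by (rule dim_image_eq[OF f])
  moreover have "dim (f ` ?W) \<le> dim (f ` L)"
    by (intro dim_subset image_mono) auto
  ultimately show ?thesis by linarith
qed

text \<open>The kernel is itself a competitor at 0, and rank-nullity bounds its dimension from
  below.\<close>

lemma F1_zero_ge:
  fixes G :: "('v::finite, 'e::finite) pre_digraph"
  shows "real (card (arcs G)) - real (dim (range (c1 G))) \<le> F1 G 0"
proof -
  let ?L = "l2_on (arcs G)"
  let ?K = "{x \<in> ?L. c1 G x = 0}"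
  have "subspace ?K"
    using subspace_l2_on[of "arcs G"] linear_c1[of G]
    by (auto simp: subspace_def linear_add linear_scale linear_0)
  then have "real (dim ?K) \<le> F1 G 0"
    unfolding F1_def spectral_density_def
    by (intro cSup_upper spectral_density_bdd_above) auto
  moreover have "card (arcs G) \<le> dim ?K + dim (c1 G ` ?L)"
    using dim_le_dim_kernel_plus_dim_image[OF linear_c1 subspace_l2_on] by (simp add: dim_l2_on)
  moreover have "dim (c1 G ` ?L) \<le> dim (range (c1 G))" by (rule dim_subset) auto
  ultimately show ?thesis by linarith
qed

section \<open>The linear estimate\<close>

lemma F1_diff_le:
  fixes G :: "('v::finite, 'e::finite) pre_digraph"
  assumes "0 \<le> l"
  shows "F1 G l - F1 G 0 \<le> real (card (arcs G)) * l"
proof (cases "l = 0")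
  case False
  then have l: "l > 0" using assms by simp
  let ?A = "{(u, v). \<exists>e\<in>arcs G. {u, v} = {tail G e, head G e}}"
  have "sym ?A" by (auto simp: sym_def insert_commute)
  then obtain r f :: "'v \<Rightarrow> 'v" and h :: "'v \<Rightarrow> nat"
    where r: "\<And>u v. (u, v) \<in> ?A \<Longrightarrow> r u = r v"
      and f: "\<And>v. r v \<noteq> v \<Longrightarrow> (f v, v) \<in> ?A"
      and h: "\<And>v. r v \<noteq> v \<Longrightarrow> h (f v) < h v"
    using exists_spanning_forest by blast
  define N where "N = {v. r v \<noteq> v}"
  have "\<forall>v\<in>N. \<exists>e\<in>arcs G. {f v, v} = {tail G e, head G e}" using f by (auto simp: N_def)
  then obtain p where p: "\<And>v. v \<in> N \<Longrightarrow> p v \<in> arcs G"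
    "\<And>v. v \<in> N \<Longrightarrow> {f v, v} = {tail G (p v), head G (p v)}" by metis
  have dec: "h (f v) < h v" if "v \<in> N" for v using that h by (simp add: N_def)
  have inj: "inj_on p N"
  proof (rule inj_onI)
    fix u v
    assume "u \<in> N" "v \<in> N" "p u = p v"
    \<comment> \<open>The two ends of the arc determine \<open>v\<close>: it is the one of larger
      height.\<close>
    then have "{f u, u} = {f v, v}" using p(2) by metis
    then show "u = v" using dec \<open>u \<in> N\<close> \<open>v \<in> N\<close>
      by (metis doubleton_eq_iff less_asym)
  qed
  have cardN: "card N \<le> card (arcs G)"
    using card_inj_on_le[OF inj, of "arcs G"] p(1) by auto

  have "dim (range (c1 G)) \<le> card N"
  proof -
    let ?S = "span ((\<lambda>v. axis v 1 - axis (f v) 1 :: real ^ 'v) ` N)"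
    \<comment> \<open>Adding the tree edges from \<open>v\<close> up to its root gives this
      difference. The ends of an arc share a root, so subtracting two such vectors yields the
      boundary of any arc.\<close>
    have root: "axis v 1 - axis (r v) 1 \<in> ?S" for v
    proof (induction "h v" arbitrary: v rule: less_induct)
      case less
      show ?case
      proof (cases "v \<in> N")
        case True
        then have "axis v 1 - axis (f v) 1 \<in> ?S" by (intro span_base) auto
        moreover have "axis (f v) 1 - axis (r v) 1 \<in> ?S"
          using less[of "f v"] dec[OF True] r[of "f v" v] f[of v] True by (simp add: N_def)
        ultimately show ?thesis using span_add by fastforce
      qed (simp add: N_def span_zero)
    qed
    have "axis (head G e) 1 - axis (tail G e) 1 \<in> ?S" if "e \<in> arcs G" for e
    proof -
      have "r (head G e) = r (tail G e)" using that by (intro r) auto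
      then show ?thesis using span_diff[OF root[of "head G e"] root[of "tail G e"]] by simp
    qed
    then have "range (c1 G) \<subseteq> ?S"
      by (auto simp: c1_eq_sum intro!: span_sum span_scale)
    then have "dim (range (c1 G)) \<le> card ((\<lambda>v. axis v 1 - axis (f v) 1 :: real ^ 'v) ` N)"
      by (rule dim_le_card) simp
    also have "\<dots> \<le> card N" by (rule card_image_le) simp
    finally show ?thesis .
  qed
  then have F0: "real (card (arcs G)) - real (card N) \<le> F1 G 0"
    using F1_zero_ge[of G] by linarith

  \<comment> \<open>The least \<open>k\<close> with \<open>k * l\<close> at least 1: cutting
    subtrees of size \<open>k\<close> is cheap enough, while \<open>k - 1\<close> still keeps the
    norm bound strict.\<close>
  define k where "k = nat \<lceil>1 / l\<rceil>"
  have k: "1 / l \<le> real k" "real (k - 1) * l < 1"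
  proof -
    show "1 / l \<le> real k" unfolding k_def using l by linarith
    \<comment> \<open>Positivity ensures that neither \<open>nat\<close> nor the subtraction
      \<open>k - 1\<close> truncates.\<close>
    have "0 < \<lceil>1 / l\<rceil>" using l by simp
    then have "real (k - 1) < 1 / l" unfolding k_def by linarith
    then show "real (k - 1) * l < 1" using l by (simp add: field_simps)
  qed
  obtain C where C: "C \<subseteq> N" "k * card C \<le> card N"
    and small: "\<And>v. v \<in> N - C \<Longrightarrow> card (descendants (N - C) f v) < k"
    using exists_forest_cut[of N h f k, OF _ dec] by auto
  define M where "M = N - C"
  have MN: "M \<subseteq> N" by (auto simp: M_def)
  let ?W = "l2_on (p ` M) :: (real ^ 'e) set"
  have pM: "p ` M \<subseteq> arcs G" using p(1) MN by auto
  then have "?W \<subseteq> l2_on (arcs G)" unfolding l2_on_def by blast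
  moreover have "x = 0" if x: "x \<in> ?W" "norm (c1 G x) \<le> l * norm x" for x
  proof -
    \<comment> \<open>The coefficients of \<open>x\<close> after reorienting every forest edge from
      parent to child.\<close>
    define X where "X v = (if head G (p v) = v then x $ p v else - x $ p v)" for v
    have c1x: "c1 G x $ v = X v - (\<Sum>u | u \<in> M \<and> f u = v. X u)" if "v \<in> M" for v
    proof -
      have "c1 G x = (\<Sum>e\<in>p ` M. x $ e *\<^sub>R (axis (head G e) 1 - axis (tail G e) 1))"
        unfolding c1_eq_sum using x(1) pM
        by (intro sum.mono_neutral_right) (auto simp: l2_on_def)
      also have "\<dots> = (\<Sum>u\<in>M. x $ p u *\<^sub>R (axis (head G (p u)) 1 - axis (tail G (p u)) 1))"
        using inj_on_subset[OF inj MN] by (simp add: sum.reindex)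
      also have "\<dots> = (\<Sum>u\<in>M. X u *\<^sub>R (axis u 1 - axis (f u) 1))"
      proof (intro sum.cong refl)
        fix u
        assume "u \<in> M"
        then have "{f u, u} = {tail G (p u), head G (p u)}" using p(2) MN by auto
        then show "x $ p u *\<^sub>R (axis (head G (p u)) 1 - axis (tail G (p u)) 1)
            = X u *\<^sub>R (axis u 1 - axis (f u) 1 :: real ^ 'v)"
          by (auto simp: X_def doubleton_eq_iff algebra_simps)
      qed
      finally have "c1 G x $ v = (\<Sum>u\<in>M. (if u = v then X u else 0) - (if f u = v then X u else 0))"
        by (simp add: axis_def) (intro sum.cong, auto)
      also have "\<dots> = X v - (\<Sum>u | u \<in> M \<and> f u = v. X u)"
        using that by (simp add: sum_subtractf sum.inter_filter)
      finally show ?thesis .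
    qed
    have "(norm x)\<^sup>2 = (\<Sum>e\<in>UNIV. (x $ e)\<^sup>2)"
      unfolding norm_vec_def L2_set_def by (simp add: sum_nonneg)
    also have "\<dots> = (\<Sum>e\<in>p ` M. (x $ e)\<^sup>2)"
      using x(1) by (intro sum.mono_neutral_right) (auto simp: l2_on_def)
    also have "\<dots> = (\<Sum>v\<in>M. (X v)\<^sup>2)"
      using inj_on_subset[OF inj MN] by (simp add: sum.reindex X_def) (intro sum.cong, auto)
    \<comment> \<open>Fewer than \<open>k\<close> descendants means at most \<open>k - 1\<close>,
      which is the constant used here.\<close>
    also have "\<dots> \<le> (real (k - 1))\<^sup>2 * (\<Sum>v\<in>M. (X v - (\<Sum>u | u \<in> M \<and> f u = v. X u))\<^sup>2)"
      using small dec MN by (intro forest_bounded_below[where h = h]) (force simp: M_def)+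
    also have "\<dots> = (real (k - 1))\<^sup>2 * (\<Sum>v\<in>M. (c1 G x $ v)\<^sup>2)"
      using c1x by simp
    also have "\<dots> \<le> (real (k - 1))\<^sup>2 * (\<Sum>v\<in>UNIV. (c1 G x $ v)\<^sup>2)"
      by (intro mult_left_mono sum_mono2) auto
    also have "\<dots> = (real (k - 1) * norm (c1 G x))\<^sup>2"
      unfolding norm_vec_def L2_set_def by (simp add: sum_nonneg power_mult_distrib)
    finally have "norm x \<le> real (k - 1) * norm (c1 G x)"
      by (rule power2_le_imp_le) simp
    also have "\<dots> \<le> real (k - 1) * l * norm x"
      using x(2) by (simp add: mult.assoc mult_left_mono)
    finally have "(1 - real (k - 1) * l) * norm x \<le> 0" by (simp add: algebra_simps)
    then show "x = 0" using k(2) by (simp add: mult_le_0_iff)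
  qed
  ultimately have "F1 G l \<le> real (card (arcs G)) - real (dim ?W)"
    by (intro F1_le subspace_l2_on)
  also have "dim ?W = card M"
    by (simp add: dim_l2_on card_image inj_on_subset[OF inj MN])
  also have "real (card M) = real (card N) - real (card C)"
    unfolding M_def using C(1) by (simp add: card_Diff_subset finite_subset card_mono)
  finally have "F1 G l - F1 G 0 \<le> real (card C)" using F0 by linarith
  \<comment> \<open>Since \<open>k * l\<close> is at least 1, the factor \<open>k\<close> can be
    inserted and spent on \<open>k * card C \<le> card N\<close>.\<close>
  also have "\<dots> \<le> real k * l * real (card C)"
    using k(1) l mult_right_mono[of 1 "real k * l" "real (card C)"] by (simp add: field_simps)
  also have "\<dots> = real (k * card C) * l" by simp
  also have "\<dots> \<le> real (card (arcs G)) * l"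
    using C(2) cardN l by (intro mult_right_mono) linarith+
  finally show ?thesis .
qed simp

theorem theorem1p1:
  fixes G :: "('v::finite, 'e::finite) pre_digraph" and l :: real
  assumes "fin_digraph G"
    and "0 \<le> l" and "l < 1"
  shows "F1 G l - F1 G 0 \<le> 2 * real (card (arcs G)) * real (graph_degree G) * l"
proof (cases "arcs G = {}")
  \<comment> \<open>Without arcs both bounds are 0. Otherwise the degree is at least 1, so the
    factor \<open>2 * graph_degree G\<close> only weakens the linear estimate.\<close>
  case True
  then show ?thesis using F1_diff_le[OF assms(2), of G] by simp
next
  case False
  then have "1 \<le> real (graph_degree G)" using graph_degree_pos assms(1) by fastforce
  then have "card (arcs G) * l * 1 \<le> card (arcs G) * l * (2 * real (graph_degree G))"
    using assms(2) by (intro mult_left_mono) auto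
  then show ?thesis using F1_diff_le[OF assms(2), of G] by (simp add: mult_ac)
qed

end
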